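(* Let $(\mathbb{X},d)$ be a proper complete metric space and let $\mathcal{F}=(\mathbb{X};f_1,f_2,\dots,f_N)$ be an iterated function system on $\mathbb{X}$ with attractor $A$ and basin of attraction $U$. If $\{x_k\}_{k=0}^{\infty}$ is a random orbit of a point $x_0\in U$ under $\mathcal{F}$, then, with probability one, $$A=\lim_{K\to\infty}\{x_k\}_{k=K}^{\infty},$$ where the limit (of the tail sets $\{x_k : k\ge K\}$ as $K\to\infty$) is with respect to the Hausdorff metric, i.e. $d_{\mathbb{H}}(A,\{x_k:k\ge K\})\to 0$ as $K\to\infty$.
   Context: A metric space is proper if every closed ball $\{y: d(x,y)\le r\}$ is compact. An iterated function system (IFS) $\mathcal{F}=(\mathbb{X};f_1,\dots,f_N)$ on a complete metric space $(\mathbb{X},d)$ consists of finitely many continuous maps $f_n:\mathbb{X}\to\mathbb{X}$, $n=1,\dots,N$ (no contractivity is assumed). The same symbol denotes the map on subsets $\mathcal{F}(B)=\bigcup_{n=1}^N f_n(B)$ for $B\subset\mathbb{X}$; $\mathcal{F}^k$ is its $k$-fold composition, with $\mathcal{F}^0(B)=B$. $\mathbb{H}=\mathbb{H}(\mathbb{X})$ is the set of nonempty compact subsets of $\mathbb{X}$, and for $U\subset\mathbb{X}$, $\mathbb{H}(U)$ is the set of nonempty compact subsets of $\mathbb{X}$ contained in $U$. For $S\subset\mathbb{X}$ and $r>0$ let $S+r=\{y\in\mathbb{X}: d(x,y)<r\text{ for some }x\in S\}$. The Hausdorff metric is $d_{\mathbb{H}}(B,C)=\inf\{r>0: B\subset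 C+r\text{ and }C\subset B+r\}$. The same formula is used for nonempty sets that are not necessarily compact (with $\inf\emptyset=\infty$), such as the tail sets of an orbit. Attractor and basin: a nonempty compact set $A\subset\mathbb{X}$ is an attractor of $\mathcal{F}$ if (i) $\mathcal{F}(A)=A$, and (ii) there is an open set $U\subset\mathbb{X}$ with $A\subset U$ and $\lim_{k\to\infty}\mathcal{F}^k(B)=A$ in the Hausdorff metric for all $B\in\mathbb{H}(U)$. The largest open set $U$ for which (ii) holds is called the basin of attraction of $A$. Random orbit: fix $p\in(0,1/N]$. A sequence $\{x_k\}_{k=0}^\infty$ in $\mathbb{X}$ is a random orbit of $x_0\in\mathbb{X}$ if $x_k=f_{\sigma_k}(x_{k-1})$ for $k\ge1$, where $\sigma_1,\sigma_2,\dots$ are random variables with values in $\{1,\dots,N\}$ such that for all $k\ge1$ and all $n\in\{1,\dots,N\}$, regardless of the preceding outcomes, $$P(\sigma_k=n\mid x_0,\sigma_1,\sigma_2,\dots,\sigma_{k-1})\ge p.$$ No independence, identical distribution or stationarity of the $\sigma_k$ is assumed. *)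

theory Defs
  imports "HOL-Probability.Probability"
begin

definition ifs :: "nat \<Rightarrow> (nat \<Rightarrow> 'a::metric_space \<Rightarrow> 'a) \<Rightarrow> bool" where
  "ifs N f \<longleftrightarrow> N \<ge> 1 \<and> (\<forall>n\<in>{1..N}. continuous_on UNIV (f n))"

definition ifs_map :: "nat \<Rightarrow> (nat \<Rightarrow> 'a \<Rightarrow> 'a) \<Rightarrow> 'a set \<Rightarrow> 'a set" where
  "ifs_map N f B = (\<Union>n\<in>{1..N}. f n ` B)"

definition thicken :: "'a::metric_space set \<Rightarrow> real \<Rightarrow> 'a set" where
  "thicken S r = {y. \<exists>x\<in>S. dist x y < r}"

(* Extended-real valued, so that the infimum of the empty set is infinity,
   as needed for sets that are not compact. *)
definition hausdorff_dist :: "'a::metric_space set \<Rightarrow> 'a set \<Rightarrow> ereal" where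
  "hausdorff_dist B C = (INF r\<in>{r. 0 < r \<and> B \<subseteq> thicken C r \<and> C \<subseteq> thicken B r}. ereal r)"

definition attracting_nhd ::
  "nat \<Rightarrow> (nat \<Rightarrow> 'a::metric_space \<Rightarrow> 'a) \<Rightarrow> 'a set \<Rightarrow> 'a set \<Rightarrow> bool" where
  "attracting_nhd N f A U \<longleftrightarrow> open U \<and> A \<subseteq> U \<and>
     (\<forall>B. B \<noteq> {} \<and> compact B \<and> B \<subseteq> U \<longrightarrow>
        (\<lambda>k. hausdorff_dist ((ifs_map N f ^^ k) B) A) \<longlonglongrightarrow> 0)"

definition attractor :: "nat \<Rightarrow> (nat \<Rightarrow> 'a::metric_space \<Rightarrow> 'a) \<Rightarrow> 'a set \<Rightarrow> bool" where
  "attractor N f A \<longleftrightarrow>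
     A \<noteq> {} \<and> compact A \<and> ifs_map N f A = A \<and> (\<exists>U. attracting_nhd N f A U)"

definition basin_of_attraction ::
  "nat \<Rightarrow> (nat \<Rightarrow> 'a::metric_space \<Rightarrow> 'a) \<Rightarrow> 'a set \<Rightarrow> 'a set \<Rightarrow> bool" where
  "basin_of_attraction N f A U \<longleftrightarrow>
     attracting_nhd N f A U \<and> (\<forall>V. attracting_nhd N f A V \<longrightarrow> V \<subseteq> U)"

(* The starting point x0 is deterministic, so conditioning on it is vacuous. As the \<sigma> k take
   finitely many values, conditioning on \<sigma> 1, ..., \<sigma> (k - 1) amounts to conditioning on every
   outcome history s that has positive probability; cond_prob is a junk value for null events. *)
definition random_orbit ::
  "'w measure \<Rightarrow> nat \<Rightarrow> (nat \<Rightarrow> 'a \<Rightarrow> 'a) \<Rightarrow> real \<Rightarrow> 'a \<Rightarrow> (nat \<Rightarrow> 'w \<Rightarrow> 'a) \<Rightarrow> bool" where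
  "random_orbit M N f p x0 x \<longleftrightarrow>
     (\<exists>\<sigma> :: nat \<Rightarrow> 'w \<Rightarrow> nat.
        (\<forall>k\<ge>1. \<sigma> k \<in> measurable M (count_space {1..N})) \<and>
        (\<forall>k\<ge>1. \<forall>n\<in>{1..N}. \<forall>s :: nat \<Rightarrow> nat.
           \<P>(\<omega> in M. \<forall>j\<in>{1..<k}. \<sigma> j \<omega> = s j) > 0 \<longrightarrow>
           \<P>(\<omega> in M. \<sigma> k \<omega> = n \<bar> (\<forall>j\<in>{1..<k}. \<sigma> j \<omega> = s j)) \<ge> p) \<and>
        (\<forall>\<omega>\<in>space M. x 0 \<omega> = x0 \<and> (\<forall>k\<ge>1. x k \<omega> = f (\<sigma> k \<omega>) (x (k - 1) \<omega>))))"

end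

theory Submission
  imports Defs
begin

text \<open>
  Convergence of the tails in the Hausdorff metric has two halves. One is deterministic: the
  \<open>k\<close>-th point of every orbit of \<open>x0\<close> lies in the \<open>k\<close>-th iterate of the singleton \<open>{x0}\<close>, and
  these iterates converge to \<open>A\<close>, so every tail that starts late enough lies close to \<open>A\<close>.

  The other half, that almost surely every tail comes close to every point \<open>a\<close> of \<open>A\<close>, combines
  compactness with a repeated-trials argument. From any \<open>y\<close> in \<open>A\<close> some finite word of maps
  carries \<open>y\<close> into a given ball about \<open>a\<close>, because the iterates of \<open>{y}\<close> converge to \<open>A\<close> as well.
  By continuity the same word works for all points near \<open>y\<close>; as \<open>A\<close> is compact, finitely many
  words serve a whole neighbourhood of \<open>A\<close> (\<open>bounded_steering_near_attractor\<close>). Let \<open>L\<close> bound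
  their lengths. A late orbit point is in that neighbourhood, so whatever has happened before, the
  next \<open>L\<close> letters steer the orbit into the ball with conditional probability at least \<open>p ^ L\<close>.
  Hence \<open>j\<close> consecutive blocks of \<open>L\<close> letters all fail with probability at most
  \<open>(1 - p ^ L) ^ j\<close> (\<open>prob_miss_block\<close>), which tends to \<open>0\<close> (\<open>AE_history_hits\<close>). Finite nets
  of \<open>A\<close> of mesh \<open>1 / (n + 1)\<close> reduce the claim for all \<open>a\<close> and all radii to countably many
  almost sure events.
\<close>

section \<open>Words and orbits\<close>

text \<open>
  A word is a list of indices of maps, and \<open>fold f w\<close> applies the map of its first letter first.
  Thus appending letters to a word continues the orbit, in the order in which the random letters
  are drawn.
\<close>

lemma ifs_map_power_singleton:
  "(ifs_map N f ^^ k) {y} = {fold f w y | w. set w \<subseteq> {1..N} \<and> length w = k}"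
proof (induction k)
  case 0
  show ?case by auto
next
  case (Suc k)
  have "(ifs_map N f ^^ Suc k) {y}
      = {f n (fold f w y) | n w. n \<in> {1..N} \<and> set w \<subseteq> {1..N} \<and> length w = k}"
    unfolding funpow.simps comp_apply Suc ifs_map_def by blast
  also have "\<dots> = {fold f v y | v. set v \<subseteq> {1..N} \<and> length v = Suc k}"
  proof (intro set_eqI iffI)
    fix z assume "z \<in> {f n (fold f w y) | n w. n \<in> {1..N} \<and> set w \<subseteq> {1..N} \<and> length w = k}"
    then obtain n w where "z = fold f (w @ [n]) y" "set (w @ [n]) \<subseteq> {1..N}" "length (w @ [n]) = Suc k"
      by auto
    then show "z \<in> {fold f v y | v. set v \<subseteq> {1..N} \<and> length v = Suc k}" by blast
  next
    fix z assume "z \<in> {fold f v y | v. set v \<subseteq> {1..N} \<and> length v = Suc k}"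
    then obtain v where v: "z = fold f v y" "set v \<subseteq> {1..N}" "length v = Suc k" by blast
    then obtain w n where "v = w @ [n]" by (cases v rule: rev_cases) auto
    with v show "z \<in> {f n (fold f w y) | n w. n \<in> {1..N} \<and> set w \<subseteq> {1..N} \<and> length w = k}"
      by auto
  qed
  finally show ?case .
qed

lemma continuous_on_fold_word:
  assumes "ifs N f" "set w \<subseteq> {1..N}"
  shows "continuous_on UNIV (fold f w)"
  using assms(2)
proof (induction w)
  case Nil
  show ?case by (simp add: id_def)
next
  case (Cons n w)
  have "continuous_on UNIV (f n)" using assms(1) Cons.prems by (auto simp: ifs_def)
  moreover have "continuous_on (range (f n)) (fold f w)"
    using Cons by (auto intro: continuous_on_subset)
  ultimately have "continuous_on UNIV (fold f w \<circ> f n)"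
    by (rule continuous_on_compose)
  then show ?case by (simp add: comp_def)
qed

section \<open>The Hausdorff distance\<close>

lemma hausdorff_dist_lessD:
  assumes "hausdorff_dist B C < ereal e"
  shows "B \<subseteq> thicken C e" "C \<subseteq> thicken B e"
proof -
  obtain r where "r < e" "B \<subseteq> thicken C r" "C \<subseteq> thicken B r"
    using assms by (auto simp: hausdorff_dist_def INF_less_iff)
  then show "B \<subseteq> thicken C e" "C \<subseteq> thicken B e"
    by (force simp: thicken_def)+
qed

lemma hausdorff_dist_tendsto_0I:
  assumes "\<And>e. e > 0 \<Longrightarrow> \<forall>\<^sub>F k in F. B k \<subseteq> thicken (C k) e \<and> C k \<subseteq> thicken (B k) e"
  shows "((\<lambda>k. hausdorff_dist (B k) (C k)) \<longlongrightarrow> 0) F"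
proof (rule order_tendstoI)
  fix a :: ereal assume "a < 0"
  moreover have "0 \<le> hausdorff_dist (B k) (C k)" for k
    by (auto simp: hausdorff_dist_def intro!: INF_greatest)
  ultimately show "\<forall>\<^sub>F k in F. a < hausdorff_dist (B k) (C k)"
    by (simp add: order_less_le_trans)
next
  fix a :: ereal assume "0 < a"
  then obtain e where e: "0 < e" "ereal e < a"
    using ereal_dense2[of 0 a] by auto
  show "\<forall>\<^sub>F k in F. hausdorff_dist (B k) (C k) < a"
    using assms[OF e(1)]
  proof eventually_elim
    case (elim k)
    then have "hausdorff_dist (B k) (C k) \<le> ereal e"
      unfolding hausdorff_dist_def using e(1) by (intro INF_lower) auto
    then show ?case using e(2) by order
  qed
qed

section \<open>Steering orbits towards a point of the attractor\<close>

lemma attracting_nhd_orbit_near: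
  assumes "attracting_nhd N f A U" "y \<in> U" "e > 0"
  shows "\<forall>\<^sub>F k in sequentially. (ifs_map N f ^^ k) {y} \<subseteq> thicken A e \<and>
           A \<subseteq> thicken ((ifs_map N f ^^ k) {y}) e"
proof -
  have "(\<lambda>k. hausdorff_dist ((ifs_map N f ^^ k) {y}) A) \<longlonglongrightarrow> 0"
    using assms(1,2) by (auto simp: attracting_nhd_def)
  then have "\<forall>\<^sub>F k in sequentially. hausdorff_dist ((ifs_map N f ^^ k) {y}) A < ereal e"
    using assms(3) by (intro order_tendstoD) auto
  then show ?thesis
    by (rule eventually_mono) (auto dest: hausdorff_dist_lessD)
qed

text \<open>
  The sets of points that a given word sends into \<open>ball a e\<close> are open and cover the compact set \<open>A\<close>.
  A finite subcover bounds the word lengths, and it covers not only \<open>A\<close> but a whole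
  \<open>r\<close>-neighbourhood of it, which is what makes the bound applicable to orbits that only approach \<open>A\<close>.
\<close>

lemma bounded_steering_near_attractor:
  assumes f: "ifs N f" and A: "compact A" "A \<subseteq> U" "attracting_nhd N f A U"
    and a: "a \<in> A" and e: "e > 0"
  obtains r L where "r > 0"
    "\<And>y. y \<in> thicken A r \<Longrightarrow>
       \<exists>w. set w \<subseteq> {1..N} \<and> length w \<le> L \<and> dist (fold f w y) a < e"
proof -
  let ?W = "{w. set w \<subseteq> {1..N}}"
  define G where "G w = fold f w -` ball a e" for w
  have "open (G w)" if "w \<in> ?W" for w
    using continuous_on_fold_word[OF f] that
    by (auto simp: G_def intro: open_vimage)
  moreover have "A \<subseteq> (\<Union>w\<in>?W. G w)"
  proof
    fix y assume "y \<in> A"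
    then have "\<forall>\<^sub>F k in sequentially. A \<subseteq> thicken ((ifs_map N f ^^ k) {y}) e"
      using attracting_nhd_orbit_near[OF A(3) _ e] A(2)
      by (fastforce elim: eventually_mono)
    then obtain k where "A \<subseteq> thicken ((ifs_map N f ^^ k) {y}) e"
      by (auto simp: eventually_sequentially)
    with a obtain w where "set w \<subseteq> {1..N}" "dist (fold f w y) a < e"
      by (auto simp: ifs_map_power_singleton thicken_def)
    then show "y \<in> (\<Union>w\<in>?W. G w)" by (auto simp: G_def dist_commute)
  qed
  ultimately obtain W' where W': "W' \<subseteq> ?W" "finite W'" "A \<subseteq> (\<Union>w\<in>W'. G w)"
    using A(1) by (metis (no_types, lifting) compactE_image)
  have "open (\<Union>w\<in>W'. G w)"
    using W'(1) \<open>\<And>w. w \<in> ?W \<Longrightarrow> open (G w)\<close> by blast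
  then obtain r where r: "r > 0" "(\<Union>x\<in>A. ball x r) \<subseteq> (\<Union>w\<in>W'. G w)"
    using compact_subset_open_imp_ball_epsilon_subset[OF A(1) _ W'(3)] by blast
  obtain L where L: "\<And>w. w \<in> W' \<Longrightarrow> length w \<le> L"
    using finite_nat_set_iff_bounded_le[of "length ` W'"] W'(2) by auto
  show thesis
  proof (rule that[OF r(1)])
    fix y assume "y \<in> thicken A r"
    then have "y \<in> (\<Union>x\<in>A. ball x r)" by (auto simp: thicken_def)
    then obtain w where "w \<in> W'" "y \<in> G w" using r(2) by blast
    then show "\<exists>w. set w \<subseteq> {1..N} \<and> length w \<le> L \<and> dist (fold f w y) a < e"
      using W'(1) L by (auto simp: G_def dist_commute)
  qed
qed

section \<open>Random words whose letters are never unlikely\<close>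

text \<open>
  The letters may depend on each other in any way; what matters is that, after every history of
  positive probability, each letter still has conditional probability at least \<open>p\<close>. Letters are
  indexed from \<open>1\<close>, so that \<open>\<sigma> k\<close> drives the step from time \<open>k - 1\<close> to time \<open>k\<close>.
\<close>

locale random_letters = prob_space M for M :: "'w measure" +
  fixes N :: nat and \<sigma> :: "nat \<Rightarrow> 'w \<Rightarrow> nat" and p :: real
  assumes letter_measurable: "k \<ge> 1 \<Longrightarrow> \<sigma> k \<in> measurable M (count_space {1..N})"
    and letter_prob: "k \<ge> 1 \<Longrightarrow> n \<in> {1..N} \<Longrightarrow>
      \<P>(\<omega> in M. \<forall>j\<in>{1..<k}. \<sigma> j \<omega> = s j) > 0 \<Longrightarrow>
      \<P>(\<omega> in M. \<sigma> k \<omega> = n \<bar> (\<forall>j\<in>{1..<k}. \<sigma> j \<omega> = s j)) \<ge> p"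
    and p_pos: "0 < p" and p_le_1: "p \<le> 1"
begin

definition history :: "nat \<Rightarrow> 'w \<Rightarrow> nat list" where
  "history k \<omega> = map (\<lambda>j. \<sigma> j \<omega>) [1..<Suc k]"

definition cylinder :: "nat list \<Rightarrow> 'w set" where
  "cylinder h = {\<omega> \<in> space M. history (length h) \<omega> = h}"

lemma length_history [simp]: "length (history k \<omega>) = k"
  by (simp add: history_def)

lemma history_Suc: "history (Suc k) \<omega> = history k \<omega> @ [\<sigma> (Suc k) \<omega>]"
  by (simp add: history_def)

lemma take_history: "i \<le> k \<Longrightarrow> take i (history k \<omega>) = history i \<omega>"
  by (simp add: history_def take_map del: upt_Suc)

lemma set_history: "\<omega> \<in> space M \<Longrightarrow> set (history k \<omega>) \<subseteq> {1..N}"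
  using letter_measurable by (fastforce simp: history_def dest: measurable_space)

lemma nth_history: "i < k \<Longrightarrow> history k \<omega> ! i = \<sigma> (Suc i) \<omega>"
  by (simp add: history_def del: upt_Suc)

lemma cylinder_eq:
  "cylinder h = {\<omega> \<in> space M. \<forall>j\<in>{1..<Suc (length h)}. \<sigma> j \<omega> = h ! (j - 1)}"
proof -
  have "history (length h) \<omega> = h \<longleftrightarrow> (\<forall>j\<in>{1..<Suc (length h)}. \<sigma> j \<omega> = h ! (j - 1))" for \<omega>
  proof
    assume eq: "history (length h) \<omega> = h"
    show "\<forall>j\<in>{1..<Suc (length h)}. \<sigma> j \<omega> = h ! (j - 1)"
    proof
      fix j assume j: "j \<in> {1..<Suc (length h)}"
      then have "history (length h) \<omega> ! (j - 1) = \<sigma> j \<omega>"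
        by (subst nth_history) auto
      then show "\<sigma> j \<omega> = h ! (j - 1)" by (simp only: eq)
    qed
  next
    assume letters: "\<forall>j\<in>{1..<Suc (length h)}. \<sigma> j \<omega> = h ! (j - 1)"
    show "history (length h) \<omega> = h"
    proof (rule nth_equalityI)
      fix i assume "i < length (history (length h) \<omega>)"
      then have "i < length h" by simp
      then show "history (length h) \<omega> ! i = h ! i"
        using letters[rule_format, of "Suc i"] by (simp add: nth_history)
    qed simp
  qed
  then show ?thesis unfolding cylinder_def by blast
qed

lemma cylinder_measurable [measurable]: "cylinder h \<in> events"
proof -
  have "{\<omega> \<in> space M. \<sigma> j \<omega> = n} \<in> events" if "j \<ge> 1" for j n
  proof -
    have [measurable]: "\<sigma> j \<in> measurable M (count_space {1..N})"
      using letter_measurable that by blast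
    show ?thesis by measurable
  qed
  then show ?thesis
    unfolding cylinder_eq by (intro sets.sets_Collect_finite_All) auto
qed

lemma history_measurable [measurable]: "history k \<in> measurable M (count_space UNIV)"
proof (subst measurable_count_space_eq2_countable, safe)
  fix h :: "nat list"
  have "history k -` {h} \<inter> space M = (if length h = k then cylinder h else {})"
    by (auto simp: cylinder_def)
  then show "history k -` {h} \<inter> space M \<in> events" by simp
qed auto

lemma cylinder_snoc: "cylinder (h @ [n]) = {\<omega> \<in> cylinder h. \<sigma> (Suc (length h)) \<omega> = n}"
  by (auto simp: cylinder_def history_Suc)

lemma prob_cylinder_snoc:
  assumes "n \<in> {1..N}"
  shows "p * prob (cylinder h) \<le> prob (cylinder (h @ [n]))"
proof (cases "prob (cylinder h) = 0")
  case True
  then show ?thesis by simp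
next
  case False
  define k where "k = Suc (length h)"
  define R where "R \<omega> \<longleftrightarrow> (\<forall>j\<in>{1..<k}. \<sigma> j \<omega> = h ! (j - 1))" for \<omega>
  have R: "{\<omega> \<in> space M. R \<omega>} = cylinder h"
    unfolding R_def k_def by (rule cylinder_eq[symmetric])
  have "p \<le> \<P>(\<omega> in M. \<sigma> k \<omega> = n \<bar> R \<omega>)"
    unfolding R_def
  proof (rule letter_prob)
    show "\<P>(\<omega> in M. \<forall>j\<in>{1..<k}. \<sigma> j \<omega> = h ! (j - 1)) > 0"
      using False R unfolding R_def by (simp add: zero_less_measure_iff)
  qed (use assms in \<open>auto simp: k_def\<close>)
  moreover have "{\<omega> \<in> space M. \<sigma> k \<omega> = n \<and> R \<omega>} = cylinder (h @ [n])"
    unfolding cylinder_snoc R[symmetric] k_def by blast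
  ultimately have "p \<le> prob (cylinder (h @ [n])) / prob (cylinder h)"
    by (simp add: cond_prob_def R)
  then show ?thesis
    using False by (simp add: pos_le_divide_eq zero_less_measure_iff)
qed

text \<open>
  This replaces independence: prescribing \<open>length w\<close> further letters costs at most one factor \<open>p\<close>
  per letter, whatever the history \<open>h\<close>.
\<close>

lemma prob_cylinder_append:
  assumes "set w \<subseteq> {1..N}"
  shows "p ^ length w * prob (cylinder h) \<le> prob (cylinder (h @ w))"
  using assms
proof (induction w rule: rev_induct)
  case Nil
  show ?case by simp
next
  case (snoc n w)
  have "p * (p ^ length w * prob (cylinder h)) \<le> p * prob (cylinder (h @ w))"
    using snoc p_pos by (intro mult_left_mono) auto
  also have "\<dots> \<le> prob (cylinder ((h @ w) @ [n]))"
    using snoc.prems by (intro prob_cylinder_snoc) auto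
  finally show ?case by (simp add: mult.assoc)
qed

definition miss :: "(nat list \<Rightarrow> bool) \<Rightarrow> nat \<Rightarrow> nat \<Rightarrow> 'w set" where
  "miss Q K m = {\<omega> \<in> space M. \<forall>k\<in>{K..m}. \<not> Q (history k \<omega>)}"

lemma miss_measurable [measurable]: "miss Q K m \<in> events"
  unfolding miss_def by measurable

text \<open>
  Whether \<open>Q\<close> has failed up to time \<open>k\<close> depends only on the history of length \<open>k\<close>, so \<open>miss Q K k\<close>
  is a disjoint union of finitely many cylinders. In each of them the steering word of that history
  removes at least the fraction \<open>p ^ L\<close>.
\<close>

lemma prob_miss_block:
  assumes steer: "\<And>h. set h \<subseteq> {1..N} \<Longrightarrow> length h \<ge> K \<Longrightarrow>
      \<exists>w. set w \<subseteq> {1..N} \<and> length w \<le> L \<and> Q (h @ w)"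
    and k: "K \<le> k"
  shows "prob (miss Q K (k + L)) \<le> (1 - p ^ L) * prob (miss Q K k)"
proof -
  define T where "T = {h. (set h \<subseteq> {1..N} \<and> length h = k) \<and> (\<forall>i\<in>{K..k}. \<not> Q (take i h))}"
  have fin: "finite T"
    unfolding T_def by (rule finite_subset[OF _ finite_lists_length_eq[of "{1..N}" k]]) auto
  have disj: "disjoint_family_on (\<lambda>h. cylinder h \<inter> D) T" for D
    by (auto simp: disjoint_family_on_def T_def cylinder_def)
  have miss_k: "miss Q K k = (\<Union>h\<in>T. cylinder h)"
  proof (intro set_eqI iffI)
    fix \<omega> assume "\<omega> \<in> miss Q K k"
    then have "history k \<omega> \<in> T" "\<omega> \<in> cylinder (history k \<omega>)"
      using set_history by (auto simp: miss_def T_def cylinder_def take_history)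
    then show "\<omega> \<in> (\<Union>h\<in>T. cylinder h)" by blast
  next
    fix \<omega> assume "\<omega> \<in> (\<Union>h\<in>T. cylinder h)"
    then have "\<omega> \<in> space M" "history k \<omega> \<in> T" by (auto simp: cylinder_def T_def)
    then show "\<omega> \<in> miss Q K k" by (auto simp: miss_def T_def take_history)
  qed
  have "miss Q K (k + L) \<subseteq> miss Q K k" by (auto simp: miss_def)
  then have split: "miss Q K (k + L) = (\<Union>h\<in>T. cylinder h \<inter> miss Q K (k + L))"
    using miss_k by blast
  \<comment> \<open>Within \<open>cylinder h\<close>, missing forces the next letters to differ from the word that steers \<open>h\<close>.\<close>
  have cyl: "prob (cylinder h \<inter> miss Q K (k + L)) \<le> (1 - p ^ L) * prob (cylinder h)"
    if "h \<in> T" for h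
  proof -
    from that have h: "set h \<subseteq> {1..N}" "length h = k" by (auto simp: T_def)
    obtain w where w: "set w \<subseteq> {1..N}" "length w \<le> L" "Q (h @ w)"
      using steer[of h] h k by auto
    have sub: "cylinder (h @ w) \<subseteq> cylinder h"
    proof
      fix \<omega> assume \<omega>: "\<omega> \<in> cylinder (h @ w)"
      then have "take (length h) (history (length (h @ w)) \<omega>) = take (length h) (h @ w)"
        by (simp add: cylinder_def)
      then have "history (length h) \<omega> = h" by (simp add: take_history)
      with \<omega> show "\<omega> \<in> cylinder h" by (simp add: cylinder_def)
    qed
    have "cylinder h \<inter> miss Q K (k + L) \<subseteq> cylinder h - cylinder (h @ w)"
    proof
      fix \<omega> assume \<omega>: "\<omega> \<in> cylinder h \<inter> miss Q K (k + L)"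
      have "length (h @ w) \<in> {K..k + L}" using h k w by simp
      with \<omega> have "\<not> Q (history (length (h @ w)) \<omega>)" unfolding miss_def by blast
      with w(3) have "\<omega> \<notin> cylinder (h @ w)" by (auto simp: cylinder_def)
      with \<omega> show "\<omega> \<in> cylinder h - cylinder (h @ w)" by blast
    qed
    then have "prob (cylinder h \<inter> miss Q K (k + L)) \<le> prob (cylinder h - cylinder (h @ w))"
      by (intro finite_measure_mono) auto
    also have "\<dots> = prob (cylinder h) - prob (cylinder (h @ w))"
      using sub by (intro finite_measure_Diff) auto
    also have "\<dots> \<le> prob (cylinder h) - p ^ length w * prob (cylinder h)"
      using prob_cylinder_append[OF w(1)] by simp
    also have "\<dots> \<le> prob (cylinder h) - p ^ L * prob (cylinder h)"
      using w(2) p_pos p_le_1 by (intro diff_left_mono mult_right_mono power_decreasing) auto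
    finally show ?thesis by (simp add: algebra_simps)
  qed
  have "prob (miss Q K (k + L)) = (\<Sum>h\<in>T. prob (cylinder h \<inter> miss Q K (k + L)))"
    by (subst split, rule finite_measure_finite_Union[OF fin _ disj]) auto
  also have "\<dots> \<le> (\<Sum>h\<in>T. (1 - p ^ L) * prob (cylinder h))"
    by (intro sum_mono cyl)
  also have "\<dots> = (1 - p ^ L) * prob (miss Q K k)"
    unfolding miss_k using finite_measure_finite_Union[OF fin _ disj[of "space M"]]
    by (simp add: sum_distrib_left image_subset_iff)
  finally show ?thesis .
qed

text \<open>
  Repeated trials: avoiding \<open>Q\<close> from time \<open>K\<close> on means failing in every block of \<open>L\<close> letters, and
  \<open>j\<close> blocks all fail with probability at most \<open>(1 - p ^ L) ^ j\<close>. The steering word may be empty,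
  when the history already satisfies \<open>Q\<close>.
\<close>

lemma AE_history_hits:
  assumes steer: "\<And>h. set h \<subseteq> {1..N} \<Longrightarrow> length h \<ge> K \<Longrightarrow>
      \<exists>w. set w \<subseteq> {1..N} \<and> length w \<le> L \<and> Q (h @ w)"
  shows "AE \<omega> in M. \<exists>k\<ge>K. Q (history k \<omega>)"
proof -
  let ?c = "1 - p ^ L"
  have c: "0 \<le> ?c" "?c < 1" using p_pos p_le_1 by (auto simp: power_le_one)
  have block: "prob (miss Q K (K + j * L)) \<le> ?c ^ j" for j
  proof (induction j)
    case 0
    show ?case by simp
  next
    case (Suc j)
    have "prob (miss Q K (K + j * L + L)) \<le> ?c * prob (miss Q K (K + j * L))"
      using steer by (rule prob_miss_block) auto
    also have "\<dots> \<le> ?c * ?c ^ j" using Suc c(1) by (rule mult_left_mono)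
    finally show ?case by (simp add: add_ac)
  qed
  define Z where "Z = {\<omega> \<in> space M. \<not> (\<exists>k\<ge>K. Q (history k \<omega>))}"
  have Z: "Z \<in> events" unfolding Z_def by measurable
  have "prob Z \<le> ?c ^ j" for j
  proof -
    have "prob Z \<le> prob (miss Q K (K + j * L))"
      by (intro finite_measure_mono) (auto simp: Z_def miss_def)
    then show ?thesis using block[of j] by simp
  qed
  then have "prob Z \<le> 0"
    using LIMSEQ_realpow_zero[OF c] by (intro LIMSEQ_le_const) auto
  then have "emeasure M Z = 0" by (simp add: emeasure_eq_measure measure_le_0_iff)
  then show ?thesis using Z by (subst AE_iff_measurable[OF Z]) (auto simp: Z_def)
qed

end

section \<open>The chaos game\<close>

theorem theorem3:
  fixes N :: nat
    and f :: "nat \<Rightarrow> 'a::complete_space \<Rightarrow> 'a"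
    and A U :: "'a set"
    and p :: real
    and M :: "'w measure"
    and x0 :: 'a
    and x :: "nat \<Rightarrow> 'w \<Rightarrow> 'a"
  assumes proper: "\<And>(y::'a) r. compact (cball y r)"
    and "ifs N f"
    and "attractor N f A"
    and "basin_of_attraction N f A U"
    and "0 < p" and "p \<le> 1 / real N"
    and "prob_space M"
    and "x0 \<in> U"
    and "random_orbit M N f p x0 x"
  shows "AE \<omega> in M. (\<lambda>K. hausdorff_dist A {x k \<omega> | k. k \<ge> K}) \<longlonglongrightarrow> 0"
proof -
  note f = \<open>ifs N f\<close>
  have A: "compact A" using \<open>attractor N f A\<close> by (simp add: attractor_def)
  have U: "attracting_nhd N f A U"
    using \<open>basin_of_attraction N f A U\<close> by (simp add: basin_of_attraction_def)
  then have AU: "A \<subseteq> U" by (simp add: attracting_nhd_def)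
  have "N \<ge> 1" using f by (simp add: ifs_def)
  then have "1 / real N \<le> 1" by simp
  then have p_le_1: "p \<le> 1" using \<open>p \<le> 1 / real N\<close> by linarith
  obtain \<sigma> :: "nat \<Rightarrow> 'w \<Rightarrow> nat" where
    measurable_\<sigma>: "\<forall>k\<ge>1. \<sigma> k \<in> measurable M (count_space {1..N})"
    and prob_\<sigma>: "\<forall>k\<ge>1. \<forall>n\<in>{1..N}. \<forall>s :: nat \<Rightarrow> nat.
        \<P>(\<omega> in M. \<forall>j\<in>{1..<k}. \<sigma> j \<omega> = s j) > 0 \<longrightarrow>
        \<P>(\<omega> in M. \<sigma> k \<omega> = n \<bar> (\<forall>j\<in>{1..<k}. \<sigma> j \<omega> = s j)) \<ge> p"
    and orbit: "\<forall>\<omega>\<in>space M. x 0 \<omega> = x0 \<and> (\<forall>k\<ge>1. x k \<omega> = f (\<sigma> k \<omega>) (x (k - 1) \<omega>))"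
    using \<open>random_orbit M N f p x0 x\<close> unfolding random_orbit_def
    by (elim exE conjE) (rule that; assumption)
  interpret prob_space M by fact
  interpret random_letters M N \<sigma> p
  proof
    show "\<sigma> k \<in> measurable M (count_space {1..N})" if "k \<ge> 1" for k
      by (rule measurable_\<sigma>[rule_format, OF that])
    show "\<P>(\<omega> in M. \<sigma> k \<omega> = n \<bar> (\<forall>j\<in>{1..<k}. \<sigma> j \<omega> = s j)) \<ge> p"
      if "k \<ge> 1" "n \<in> {1..N}" "\<P>(\<omega> in M. \<forall>j\<in>{1..<k}. \<sigma> j \<omega> = s j) > 0" for k n s
      by (rule prob_\<sigma>[rule_format, OF that])
  qed (fact \<open>0 < p\<close> p_le_1)+
  have x_eq: "x k \<omega> = fold f (history k \<omega>) x0" if "\<omega> \<in> space M" for k \<omega>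
  proof (induction k)
    case 0
    show ?case using orbit that by (simp add: history_def)
  next
    case (Suc k)
    have "x (Suc k) \<omega> = f (\<sigma> (Suc k) \<omega>) (x k \<omega>)"
      using orbit[rule_format, OF that] by (metis diff_Suc_1 le_add1 plus_1_eq_Suc)
    then show ?case by (simp add: Suc history_Suc)
  qed
  have near: "\<exists>K. \<forall>h. set h \<subseteq> {1..N} \<longrightarrow> length h \<ge> K \<longrightarrow> fold f h x0 \<in> thicken A e"
    if "e > 0" for e
  proof -
    obtain K where K: "\<And>k. k \<ge> K \<Longrightarrow> (ifs_map N f ^^ k) {x0} \<subseteq> thicken A e"
      using attracting_nhd_orbit_near[OF U \<open>x0 \<in> U\<close> \<open>e > 0\<close>]
      unfolding eventually_sequentially by blast
    have "fold f h x0 \<in> thicken A e" if "set h \<subseteq> {1..N}" "length h \<ge> K" for h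
    proof -
      have "fold f h x0 \<in> (ifs_map N f ^^ length h) {x0}"
        unfolding ifs_map_power_singleton using that(1) by blast
      then show ?thesis using K[OF that(2)] by blast
    qed
    then show ?thesis by blast
  qed
  have hit: "AE \<omega> in M. \<exists>k\<ge>K. dist (x k \<omega>) a < e" if "a \<in> A" "e > 0" for a e K
  proof -
    obtain r L where "r > 0" and steer: "\<And>y. y \<in> thicken A r \<Longrightarrow>
        \<exists>w. set w \<subseteq> {1..N} \<and> length w \<le> L \<and> dist (fold f w y) a < e"
      using bounded_steering_near_attractor[OF f A AU U \<open>a \<in> A\<close> \<open>e > 0\<close>] by blast
    obtain K' where K': "\<And>h. set h \<subseteq> {1..N} \<Longrightarrow> length h \<ge> K' \<Longrightarrow> fold f h x0 \<in> thicken A r"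
      using near[OF \<open>r > 0\<close>] by blast
    \<comment> \<open>From time \<open>K'\<close> on the orbit stays where steering is possible; \<open>K\<close> makes the hit late.\<close>
    have "AE \<omega> in M. \<exists>k\<ge>max K K'. dist (fold f (history k \<omega>) x0) a < e"
    proof (rule AE_history_hits)
      fix h assume "set h \<subseteq> {1..N}" "max K K' \<le> length h"
      then show "\<exists>w. set w \<subseteq> {1..N} \<and> length w \<le> L \<and> dist (fold f (h @ w) x0) a < e"
        using steer[OF K'[of h]] by simp
    qed
    then show ?thesis
    proof (rule AE_mp, intro AE_I2 impI)
      fix \<omega> assume "\<omega> \<in> space M" "\<exists>k\<ge>max K K'. dist (fold f (history k \<omega>) x0) a < e"
      then show "\<exists>k\<ge>K. dist (x k \<omega>) a < e" by (auto simp: x_eq)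
    qed
  qed
  \<comment> \<open>Nets inside \<open>A\<close> leave countably many pairs of a centre and a radius to consider.\<close>
  have "\<exists>T\<subseteq>A. finite T \<and> A \<subseteq> (\<Union>a\<in>T. ball a (inverse (Suc n)))" for n :: nat
    by (rule compactE_image[OF A, of A "\<lambda>a. ball a (inverse (Suc n))"]) auto
  then obtain T where T: "\<And>n. T n \<subseteq> A" "\<And>n. finite (T n)"
      "\<And>n. A \<subseteq> (\<Union>a\<in>T n. ball a (inverse (Suc n)))"
    by metis
  have "AE \<omega> in M. \<forall>K n. \<forall>a\<in>T n. \<exists>k\<ge>K. dist (x k \<omega>) a < inverse (Suc n)"
    unfolding AE_all_countable using T
    by (auto intro!: AE_finite_allI hit)
  then show ?thesis
  proof (rule AE_mp, intro AE_I2 impI)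
    fix \<omega> assume \<omega>: "\<omega> \<in> space M"
      and hits: "\<forall>K n. \<forall>a\<in>T n. \<exists>k\<ge>K. dist (x k \<omega>) a < inverse (Suc n)"
    show "(\<lambda>K. hausdorff_dist A {x k \<omega> | k. k \<ge> K}) \<longlonglongrightarrow> 0"
    proof (rule hausdorff_dist_tendsto_0I)
      fix e :: real assume "e > 0"
      then obtain n where n: "inverse (Suc n) < e / 2"
        using reals_Archimedean[of "e / 2"] by auto
      obtain K' where K': "\<And>h. set h \<subseteq> {1..N} \<Longrightarrow> length h \<ge> K' \<Longrightarrow> fold f h x0 \<in> thicken A e"
        using near[OF \<open>e > 0\<close>] by blast
      have "A \<subseteq> thicken {x k \<omega> | k. k \<ge> K} e" for K
      proof
        fix b assume "b \<in> A"
        then obtain a where a: "a \<in> T n" "dist a b < inverse (Suc n)" using T(3)[of n] by auto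
        then obtain k where k: "k \<ge> K" "dist (x k \<omega>) a < inverse (Suc n)" using hits by blast
        have "dist (x k \<omega>) b < e"
          using dist_triangle[of "x k \<omega>" b a] a(2) k(2) n by linarith
        with k(1) show "b \<in> thicken {x k \<omega> | k. k \<ge> K} e" by (auto simp: thicken_def)
      qed
      moreover have "{x k \<omega> | k. k \<ge> K} \<subseteq> thicken A e" if "K \<ge> K'" for K
        using that K' set_history[OF \<omega>] by (auto simp: x_eq[OF \<omega>])
      ultimately show "\<forall>\<^sub>F K in sequentially. A \<subseteq> thicken {x k \<omega> | k. k \<ge> K} e \<and>
          {x k \<omega> | k. k \<ge> K} \<subseteq> thicken A e"
        by (auto simp: eventually_sequentially)
    qed
  qed
qed

end
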